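(* Let $R$ be a prime ring, let $M$ be a faithful $*$-prime left $R$-module and let $S=\mathrm{End}_R(M)$. The following statements are equivalent: (a) $S$ is a prime ring. (b) $S$ is a semiprime ring. (c) $\mathrm{l.ann}_S(I)\subseteq \mathrm{r.ann}_S(I)$ holds for any (two-sided) ideal $I$ of $S$. (d) For all $f,g\in S$: $gSf=0$ implies $fSg=0$.
   Context: Rings are associative and unital. Homomorphisms of left modules are written on the right of their arguments, so in $S$ the product $fg$ means first $f$, then $g$. For submodules $N,L$ of $M$ put $N*L = N\,\mathrm{Hom}_R(M,L)=\sum\{(N)f \mid f\in \mathrm{Hom}_R(M,L)\}$. $M$ is called $*$-prime if $N*L\neq 0$ for all non-zero submodules $N,L$ of $M$. For an ideal $I$ of $S$, $\mathrm{l.ann}_S(I)=\{s\in S\mid sI=0\}$ and $\mathrm{r.ann}_S(I)=\{s\in S\mid Is=0\}$ are its left and right annihilators in $S$. *)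

theory Defs
  imports "HOL-Algebra.Module" "HOL-Algebra.Ideal_Product"
begin

subsection \<open>Prime and semiprime rings\<close>

text \<open>The library's \<^locale>\<open>primeideal\<close> is restricted to commutative rings, so it cannot
  be used here. As for prime ideals, which are proper, a prime ring is non-zero.\<close>

locale prime_ring = ring +
  assumes one_not_zero: "\<one> \<noteq> \<zero>"
    and ideal_prod_zero:
      "\<lbrakk>ideal I R; ideal J R; I \<cdot> J = {\<zero>}\<rbrakk> \<Longrightarrow> I = {\<zero>} \<or> J = {\<zero>}"

locale semiprime_ring = ring +
  assumes ideal_square_zero: "\<lbrakk>ideal I R; I \<cdot> I = {\<zero>}\<rbrakk> \<Longrightarrow> I = {\<zero>}"

definition left_ann :: "('a, 'm) ring_scheme \<Rightarrow> 'a set \<Rightarrow> 'a set"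
  where "left_ann S I = {s \<in> carrier S. \<forall>x\<in>I. s \<otimes>\<^bsub>S\<^esub> x = \<zero>\<^bsub>S\<^esub>}"

definition right_ann :: "('a, 'm) ring_scheme \<Rightarrow> 'a set \<Rightarrow> 'a set"
  where "right_ann S I = {s \<in> carrier S. \<forall>x\<in>I. x \<otimes>\<^bsub>S\<^esub> s = \<zero>\<^bsub>S\<^esub>}"


subsection \<open>Left modules over arbitrary rings\<close>

text \<open>The axioms are those of \<^locale>\<open>module\<close>, without commutativity of the ring of scalars.
  The library's \<^locale>\<open>submodule\<close> does not assume commutativity and is used as it is.\<close>

locale left_module = R?: ring R + M?: abelian_group M
  for R :: "('r, 'm) ring_scheme" (structure) and M :: "('r, 'a, 'n) module_scheme" (structure) +
  assumes smult_closed [simp, intro]: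
      "\<lbrakk>a \<in> carrier R; x \<in> carrier M\<rbrakk> \<Longrightarrow> a \<odot>\<^bsub>M\<^esub> x \<in> carrier M"
    and smult_l_distr:
      "\<lbrakk>a \<in> carrier R; b \<in> carrier R; x \<in> carrier M\<rbrakk> \<Longrightarrow>
        (a \<oplus>\<^bsub>R\<^esub> b) \<odot>\<^bsub>M\<^esub> x = a \<odot>\<^bsub>M\<^esub> x \<oplus>\<^bsub>M\<^esub> b \<odot>\<^bsub>M\<^esub> x"
    and smult_r_distr:
      "\<lbrakk>a \<in> carrier R; x \<in> carrier M; y \<in> carrier M\<rbrakk> \<Longrightarrow>
        a \<odot>\<^bsub>M\<^esub> (x \<oplus>\<^bsub>M\<^esub> y) = a \<odot>\<^bsub>M\<^esub> x \<oplus>\<^bsub>M\<^esub> a \<odot>\<^bsub>M\<^esub> y"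
    and smult_assoc1:
      "\<lbrakk>a \<in> carrier R; b \<in> carrier R; x \<in> carrier M\<rbrakk> \<Longrightarrow>
        (a \<otimes>\<^bsub>R\<^esub> b) \<odot>\<^bsub>M\<^esub> x = a \<odot>\<^bsub>M\<^esub> (b \<odot>\<^bsub>M\<^esub> x)"
    and smult_one [simp]: "x \<in> carrier M \<Longrightarrow> \<one>\<^bsub>R\<^esub> \<odot>\<^bsub>M\<^esub> x = x"

definition faithful_module ::
    "('r, 'm) ring_scheme \<Rightarrow> ('r, 'a, 'n) module_scheme \<Rightarrow> bool"
  where "faithful_module R M \<longleftrightarrow>
    (\<forall>r\<in>carrier R. (\<forall>x\<in>carrier M. r \<odot>\<^bsub>M\<^esub> x = \<zero>\<^bsub>M\<^esub>) \<longrightarrow> r = \<zero>\<^bsub>R\<^esub>)"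

text \<open>Homomorphisms are extensional functions (\<^const>\<open>undefined\<close> outside \<^term>\<open>carrier M\<close>),
  so that equality of homomorphisms is equality on \<^term>\<open>carrier M\<close>.\<close>

definition module_homs ::
    "('r, 'm) ring_scheme \<Rightarrow> ('r, 'a, 'n) module_scheme \<Rightarrow> ('r, 'b, 'k) module_scheme \<Rightarrow> ('a \<Rightarrow> 'b) set"
  where "module_homs R M N =
    {f \<in> carrier M \<rightarrow>\<^sub>E carrier N.
      (\<forall>x\<in>carrier M. \<forall>y\<in>carrier M. f (x \<oplus>\<^bsub>M\<^esub> y) = f x \<oplus>\<^bsub>N\<^esub> f y) \<and>
      (\<forall>r\<in>carrier R. \<forall>x\<in>carrier M. f (r \<odot>\<^bsub>M\<^esub> x) = r \<odot>\<^bsub>N\<^esub> f x)}"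

text \<open>Homomorphisms are written on the right of their arguments:
  the product \<open>f g\<close> in the endomorphism ring is first \<open>f\<close>, then \<open>g\<close>.\<close>

definition End_ring :: "('r, 'm) ring_scheme \<Rightarrow> ('r, 'a, 'n) module_scheme \<Rightarrow> ('a \<Rightarrow> 'a) ring"
  where "End_ring R M =
    \<lparr>carrier = module_homs R M M,
     mult = (\<lambda>f g. compose (carrier M) g f),
     one = (\<lambda>x\<in>carrier M. x),
     zero = (\<lambda>x\<in>carrier M. \<zero>\<^bsub>M\<^esub>),
     add = (\<lambda>f g. \<lambda>x\<in>carrier M. f x \<oplus>\<^bsub>M\<^esub> g x)\<rparr>"

lemma (in left_module) End_ring_is_ring: "ring (End_ring R M)"
proof (rule ringI)
  have hom_closed: "f x \<in> carrier M" if "f \<in> module_homs R M M" "x \<in> carrier M" for f x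
    using that by (auto simp: module_homs_def)
  have zero: "(\<lambda>x\<in>carrier M. \<zero>\<^bsub>M\<^esub>) \<in> module_homs R M M"
  proof -
    have "r \<odot>\<^bsub>M\<^esub> \<zero>\<^bsub>M\<^esub> = \<zero>\<^bsub>M\<^esub>" if "r \<in> carrier R" for r
    proof -
      have "r \<odot>\<^bsub>M\<^esub> \<zero>\<^bsub>M\<^esub> \<oplus>\<^bsub>M\<^esub> r \<odot>\<^bsub>M\<^esub> \<zero>\<^bsub>M\<^esub> = r \<odot>\<^bsub>M\<^esub> \<zero>\<^bsub>M\<^esub>"
        using smult_r_distr[OF that, of "\<zero>\<^bsub>M\<^esub>" "\<zero>\<^bsub>M\<^esub>"] by simp
      then show ?thesis
        using that by (metis M.add.l_cancel_one' M.zero_closed smult_closed)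
    qed
    then show ?thesis
      by (auto simp: module_homs_def)
  qed
  have add: "(\<lambda>x\<in>carrier M. f x \<oplus>\<^bsub>M\<^esub> g x) \<in> module_homs R M M"
    if "f \<in> module_homs R M M" "g \<in> module_homs R M M" for f g
    using that by (auto simp: module_homs_def smult_r_distr PiE_iff M.add.m_ac)
  show "abelian_group (End_ring R M)"
  proof (rule abelian_groupI)
    fix f assume f: "f \<in> carrier (End_ring R M)"
    let ?g = "\<lambda>x\<in>carrier M. \<ominus>\<^bsub>M\<^esub> f x"
    have smult_minus: "r \<odot>\<^bsub>M\<^esub> (\<ominus>\<^bsub>M\<^esub> y) = \<ominus>\<^bsub>M\<^esub> (r \<odot>\<^bsub>M\<^esub> y)"
      if "r \<in> carrier R" "y \<in> carrier M" for r y
    proof -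
      have z: "r \<odot>\<^bsub>M\<^esub> \<zero>\<^bsub>M\<^esub> = \<zero>\<^bsub>M\<^esub>"
        using zero that by (auto simp: module_homs_def)
      have "r \<odot>\<^bsub>M\<^esub> (\<ominus>\<^bsub>M\<^esub> y) \<oplus>\<^bsub>M\<^esub> r \<odot>\<^bsub>M\<^esub> y = \<zero>\<^bsub>M\<^esub>"
        using smult_r_distr[OF that(1), of "\<ominus>\<^bsub>M\<^esub> y" y] that z by (simp add: M.l_neg)
      then show ?thesis
        using that by (simp add: M.minus_equality)
    qed
    have "?g \<in> module_homs R M M"
      using f by (auto simp: module_homs_def End_ring_def PiE_iff M.minus_add smult_minus)
    moreover have "?g \<oplus>\<^bsub>End_ring R M\<^esub> f = \<zero>\<^bsub>End_ring R M\<^esub>"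
      using f by (auto simp: End_ring_def fun_eq_iff M.l_neg hom_closed)
    ultimately show "\<exists>g\<in>carrier (End_ring R M). g \<oplus>\<^bsub>End_ring R M\<^esub> f = \<zero>\<^bsub>End_ring R M\<^esub>"
      by (intro bexI[of _ ?g]) (simp_all add: End_ring_def)
  next
    fix f assume "f \<in> carrier (End_ring R M)"
    then show "\<zero>\<^bsub>End_ring R M\<^esub> \<oplus>\<^bsub>End_ring R M\<^esub> f = f"
      by (auto simp: End_ring_def module_homs_def fun_eq_iff PiE_iff extensional_def)
  qed (auto simp: End_ring_def zero add hom_closed M.add.m_ac fun_eq_iff)
  show "monoid (End_ring R M)"
    by (rule monoidI)
      (auto simp: End_ring_def module_homs_def compose_def fun_eq_iff PiE_iff extensional_def)
qed (auto simp: End_ring_def module_homs_def compose_def fun_eq_iff PiE_iff)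


subsection \<open>The product of submodules and \<open>*\<close>-prime modules\<close>

text \<open>The sum of the submodules \<open>(N)f\<close>, where \<open>f\<close> ranges over the homomorphisms from \<open>M\<close>
  to \<open>L\<close>: its elements are the finite sums with one summand from each of finitely many \<open>(N)f\<close>.\<close>

definition submodule_prod ::
    "('r, 'm) ring_scheme \<Rightarrow> ('r, 'a, 'n) module_scheme \<Rightarrow> 'a set \<Rightarrow> 'a set \<Rightarrow> 'a set"
  where "submodule_prod R M N L =
    {(\<Oplus>\<^bsub>M\<^esub>f\<in>F. f (u f)) | F u.
      finite F \<and> F \<subseteq> module_homs R M (M\<lparr>carrier := L\<rparr>) \<and> u \<in> F \<rightarrow> N}"

definition star_prime_module ::
    "('r, 'm) ring_scheme \<Rightarrow> ('r, 'a, 'n) module_scheme \<Rightarrow> bool"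
  where "star_prime_module R M \<longleftrightarrow>
    (\<forall>N L. submodule N R M \<and> submodule L R M \<and> N \<noteq> {\<zero>\<^bsub>M\<^esub>} \<and> L \<noteq> {\<zero>\<^bsub>M\<^esub>} \<longrightarrow>
      submodule_prod R M N L \<noteq> {\<zero>\<^bsub>M\<^esub>})"

end

theory Submission
  imports Defs
begin

text \<open>The implications (a) to (b) to (c) to (d) are pure ring theory. For (c), an ideal
  \<open>I\<close> meets its left annihilator in an ideal of square zero
  (\<open>left_ann_subset_right_ann\<close>); for (d), the annihilator condition is applied to the
  ideal of all \<open>x\<close> with \<open>g S x = 0\<close>
  (\<open>left_ann_subset_right_ann_imp_swap\<close>). The module enters in closing the cycle: if
  \<open>g S f = 0\<close> with both maps non-zero, \<open>*\<close>-primeness gives an endomorphism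
  \<open>h\<close> with image inside that of \<open>g\<close> and not vanishing on the image of
  \<open>f\<close>. Then \<open>h S f = 0\<close>, and (d) turns this into \<open>f S h = 0\<close>,
  which fails at \<open>s = 1\<close> (\<open>star_prime_swap_imp_zero\<close>). Faithfulness and
  \<open>1 \<noteq> 0\<close> in \<open>R\<close> make \<open>S\<close> non-zero.\<close>

lemma (in ring) prime_ringI_elementwise:
  assumes "\<one> \<noteq> \<zero>"
    and zero: "\<And>a b. \<lbrakk>a \<in> carrier R; b \<in> carrier R; \<forall>s\<in>carrier R. a \<otimes> s \<otimes> b = \<zero>\<rbrakk> \<Longrightarrow>
      a = \<zero> \<or> b = \<zero>"
  shows "prime_ring R"
proof (intro prime_ring.intro prime_ring_axioms.intro ring_axioms assms(1))
  fix I J assume I: "ideal I R" and J: "ideal J R" and IJ: "I \<cdot> J = {\<zero>}"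
  interpret I: ideal I R by (rule I)
  interpret J: ideal J R by (rule J)
  have "a = \<zero> \<or> b = \<zero>" if ab: "a \<in> I" "b \<in> J" for a b
  proof (rule zero)
    \<comment> \<open>Since \<open>a \<otimes> s\<close> stays in \<open>I\<close>, this is one of
      the generators of the product.\<close>
    have "a \<otimes> s \<otimes> b \<in> I \<cdot> J" if "s \<in> carrier R" for s
      using that ab by (intro ideal_prod.prod I.I_r_closed)
    then show "\<forall>s\<in>carrier R. a \<otimes> s \<otimes> b = \<zero>"
      using IJ by blast
  qed (use ab in simp_all)
  moreover have "\<zero> \<in> I" "\<zero> \<in> J"
    by simp_all
  ultimately show "I = {\<zero>} \<or> J = {\<zero>}"
    by blast
qed

lemma (in prime_ring) prime_ring_imp_semiprime: "semiprime_ring R"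
  by (intro semiprime_ring.intro semiprime_ring_axioms.intro ring_axioms)
    (use ideal_prod_zero in blast)

text \<open>Closure under right multiplication comes from \<open>(s r) x = s (r x)\<close> with
  \<open>r x\<close> again in \<open>I\<close>.\<close>

lemma (in ring) left_ann_ideal:
  assumes "ideal I R"
  shows "ideal (left_ann R I) R"
proof -
  interpret I: ideal I R by (rule assms)
  show ?thesis
  proof (rule idealI)
    show "subgroup (left_ann R I) (add_monoid R)"
      by (rule add.subgroupI)
        (auto simp: left_ann_def l_distr l_minus simp flip: a_inv_def)
  qed (auto simp: left_ann_def m_assoc I.I_l_closed ring_axioms)
qed

text \<open>In a product of two elements of \<open>?K\<close> the left factor annihilates
  \<open>I\<close> and the right one lies in \<open>I\<close>. So \<open>?K\<close> has square zero
  and vanishes, and it contains every \<open>x s\<close> with \<open>x\<close> in \<open>I\<close>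
  and \<open>s\<close> in the left annihilator.\<close>

lemma (in semiprime_ring) left_ann_subset_right_ann:
  assumes "ideal I R"
  shows "left_ann R I \<subseteq> right_ann R I"
proof -
  interpret I: ideal I R by (rule assms)
  interpret J: ideal "left_ann R I" R by (rule left_ann_ideal[OF assms])
  let ?K = "I \<inter> left_ann R I"
  have K: "ideal ?K R"
    by (rule i_intersect) unfold_locales
  have "x = \<zero>" if "x \<in> ?K \<cdot> ?K" for x
    using that
  proof (induction rule: ideal_prod.induct)
    case (prod i j)
    then have "i \<in> left_ann R I" "j \<in> I"
      by blast+
    then show ?case
      unfolding left_ann_def by blast
  qed simp
  \<comment> \<open>Semiprimeness asks for equality with \<open>{\<zero>}\<close>, so this inclusion
    is needed too.\<close>
  moreover have "\<zero> \<in> ?K \<cdot> ?K"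
    using ideal_prod.prod[of \<zero> ?K \<zero> ?K R] by simp
  ultimately have "?K = {\<zero>}"
    by (intro ideal_square_zero[OF K]) blast
  moreover have "x \<otimes> s \<in> ?K" if "s \<in> left_ann R I" "x \<in> I" for s x
    using that by (simp add: I.I_r_closed J.I_l_closed)
  ultimately show ?thesis
    by (auto simp: right_ann_def)
qed

lemma (in ring) left_ann_subset_right_ann_imp_swap:
  assumes ann: "\<And>I. ideal I R \<Longrightarrow> left_ann R I \<subseteq> right_ann R I"
    and f: "f \<in> carrier R" and g: "g \<in> carrier R" and s: "s \<in> carrier R"
    and gf: "\<forall>s\<in>carrier R. g \<otimes> s \<otimes> f = \<zero>"
  shows "f \<otimes> s \<otimes> g = \<zero>"
proof -
  \<comment> \<open>This is the right annihilator of the right ideal \<open>g S\<close>; it is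
    two-sided because \<open>g S\<close> absorbs right multiplication.\<close>
  define I where "I = {x \<in> carrier R. \<forall>s\<in>carrier R. g \<otimes> s \<otimes> x = \<zero>}"
  have I: "ideal I R"
  proof (rule idealI)
    show "subgroup I (add_monoid R)"
      by (rule add.subgroupI)
        (auto simp: I_def g r_distr r_minus simp flip: a_inv_def)
    show "x \<otimes> a \<in> I" if "a \<in> I" "x \<in> carrier R" for a x
      using that g by (auto simp: I_def) (metis m_assoc m_closed)
    show "a \<otimes> x \<in> I" if "a \<in> I" "x \<in> carrier R" for a x
      using that g by (auto simp: I_def simp flip: m_assoc)
  qed (rule ring_axioms)
  have "f \<in> I"
    using f gf by (simp add: I_def)
  then have "f \<otimes> s \<in> I"
    using s I by (simp add: ideal.I_r_closed)
  \<comment> \<open>The case \<open>s = \<one>\<close> in the definition of \<open>I\<close> gives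
    \<open>g \<otimes> x = \<zero>\<close>.\<close>
  moreover have "g \<in> left_ann R I"
    using g by (auto simp: left_ann_def I_def dest: bspec[OF _ one_closed])
  ultimately show ?thesis
    using ann[OF I] by (auto simp: right_ann_def)
qed

context left_module
begin

lemma End_ring_closed: "f \<in> carrier (End_ring R M) \<Longrightarrow> x \<in> carrier M \<Longrightarrow> f x \<in> carrier M"
  by (auto simp: End_ring_def module_homs_def)

lemma End_ring_mult_apply: "x \<in> carrier M \<Longrightarrow> (f \<otimes>\<^bsub>End_ring R M\<^esub> g) x = g (f x)"
  by (simp add: End_ring_def compose_def)

lemma End_ring_eq_zero_iff:
  assumes "f \<in> carrier (End_ring R M)"
  shows "f = \<zero>\<^bsub>End_ring R M\<^esub> \<longleftrightarrow> (\<forall>x\<in>carrier M. f x = \<zero>\<^bsub>M\<^esub>)"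
  using assms
  by (auto simp: End_ring_def module_homs_def fun_eq_iff PiE_iff extensional_def)

lemma End_ring_image_submodule:
  assumes f: "f \<in> carrier (End_ring R M)"
  shows "submodule (f ` carrier M) R M"
proof -
  have add: "f (x \<oplus>\<^bsub>M\<^esub> y) = f x \<oplus>\<^bsub>M\<^esub> f y" if "x \<in> carrier M" "y \<in> carrier M" for x y
    using f that by (simp add: End_ring_def module_homs_def)
  have smult: "f (r \<odot>\<^bsub>M\<^esub> x) = r \<odot>\<^bsub>M\<^esub> f x" if "r \<in> carrier R" "x \<in> carrier M" for r x
    using f that by (simp add: End_ring_def module_homs_def)
  have zero: "f \<zero>\<^bsub>M\<^esub> = \<zero>\<^bsub>M\<^esub>"
    using add[of "\<zero>\<^bsub>M\<^esub>" "\<zero>\<^bsub>M\<^esub>"] End_ring_closed[OF f]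
    by (metis M.add.l_cancel_one' M.zero_closed)
  have neg: "\<ominus>\<^bsub>M\<^esub> f x = f (\<ominus>\<^bsub>M\<^esub> x)" if "x \<in> carrier M" for x
    using add[of "\<ominus>\<^bsub>M\<^esub> x" x] that End_ring_closed[OF f] zero
    by (simp add: M.l_neg M.minus_equality)
  show ?thesis
  proof (intro submodule.intro submodule_axioms.intro)
    show "subgroup (f ` carrier M) (add_monoid M)"
      by (rule M.add.subgroupI)
        (auto simp: neg End_ring_closed[OF f] simp flip: a_inv_def add)
  qed (auto simp flip: smult)
qed

text \<open>A product of submodules consists of finite sums of values \<open>h x\<close>, so a
  non-zero product forces a non-zero value. A homomorphism into \<open>L\<close> becomes an
  endomorphism via the inclusion of \<open>L\<close> in \<open>M\<close>.\<close>

lemma star_prime_obtains_hom: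
  assumes "star_prime_module R M"
    and N: "submodule N R M" "N \<noteq> {\<zero>\<^bsub>M\<^esub>}" and L: "submodule L R M" "L \<noteq> {\<zero>\<^bsub>M\<^esub>}"
  obtains h x where "h \<in> carrier (End_ring R M)" "h ` carrier M \<subseteq> L" "x \<in> N" "h x \<noteq> \<zero>\<^bsub>M\<^esub>"
proof -
  interpret L: submodule L R M by (rule L)
  let ?H = "module_homs R M (M\<lparr>carrier := L\<rparr>)"
  have "\<exists>h\<in>?H. \<exists>x\<in>N. h x \<noteq> \<zero>\<^bsub>M\<^esub>"
  proof (rule ccontr)
    assume *: "\<not> ?thesis"
    have "(\<Oplus>\<^bsub>M\<^esub>f\<in>F. f (u f)) = \<zero>\<^bsub>M\<^esub>" if "F \<subseteq> ?H" "u \<in> F \<rightarrow> N" for F u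
      by (rule M.add.finprod_one_eqI) (use * that in blast)
    then have "submodule_prod R M N L \<subseteq> {\<zero>\<^bsub>M\<^esub>}"
      by (auto simp: submodule_prod_def)
    \<comment> \<open>The empty sum shows that the product is exactly \<open>{0}\<close>, which
      \<open>*\<close>-primeness excludes.\<close>
    moreover have "\<zero>\<^bsub>M\<^esub> \<in> submodule_prod R M N L"
      unfolding submodule_prod_def by (force intro: exI[of _ "{}"])
    ultimately show False
      using assms unfolding star_prime_module_def by blast
  qed
  then obtain h x where h: "h \<in> ?H" and "x \<in> N" "h x \<noteq> \<zero>\<^bsub>M\<^esub>"
    by blast
  moreover have "h \<in> carrier (End_ring R M)" "h ` carrier M \<subseteq> L"
    using h L.subset by (auto simp: module_homs_def End_ring_def PiE_iff)
  ultimately show ?thesis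
    using that by blast
qed

text \<open>If the identity of \<open>M\<close> were zero, \<open>M\<close> would be trivial and the
  scalar \<open>1\<close> would annihilate it.\<close>

lemma faithful_imp_nonzero:
  assumes "faithful_module R M" "\<one>\<^bsub>R\<^esub> \<noteq> \<zero>\<^bsub>R\<^esub>"
  shows "\<one>\<^bsub>End_ring R M\<^esub> \<noteq> \<zero>\<^bsub>End_ring R M\<^esub>"
proof
  assume "\<one>\<^bsub>End_ring R M\<^esub> = \<zero>\<^bsub>End_ring R M\<^esub>"
  then have "x = \<zero>\<^bsub>M\<^esub>" if "x \<in> carrier M" for x
    using that by (auto simp: End_ring_def fun_eq_iff split: if_splits)
  then show False
    using assms by (auto simp: faithful_module_def)
qed

text \<open>If \<open>g S f = 0\<close> with \<open>f, g \<noteq> 0\<close>, then \<open>*\<close>-primeness yields \<open>h\<close> with \<open>M h \<subseteq> M g\<close> and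
  \<open>f h \<noteq> 0\<close>. The inclusion gives \<open>h S f = 0\<close>, so that \<open>f S h = 0\<close>, contradicting \<open>f h \<noteq> 0\<close>.\<close>

lemma star_prime_swap_imp_zero:
  fixes S defines "S \<equiv> End_ring R M"
  assumes star: "star_prime_module R M"
    and swap: "\<And>f g s. \<lbrakk>f \<in> carrier S; g \<in> carrier S; s \<in> carrier S;
      \<forall>s\<in>carrier S. g \<otimes>\<^bsub>S\<^esub> s \<otimes>\<^bsub>S\<^esub> f = \<zero>\<^bsub>S\<^esub>\<rbrakk> \<Longrightarrow> f \<otimes>\<^bsub>S\<^esub> s \<otimes>\<^bsub>S\<^esub> g = \<zero>\<^bsub>S\<^esub>"
    and f: "f \<in> carrier S" and g: "g \<in> carrier S"
    and gf: "\<forall>s\<in>carrier S. g \<otimes>\<^bsub>S\<^esub> s \<otimes>\<^bsub>S\<^esub> f = \<zero>\<^bsub>S\<^esub>"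
  shows "g = \<zero>\<^bsub>S\<^esub> \<or> f = \<zero>\<^bsub>S\<^esub>"
proof (rule ccontr)
  interpret S: ring S unfolding S_def by (rule End_ring_is_ring)
  note closed = End_ring_closed[folded S_def]
    and mult_apply = End_ring_mult_apply[folded S_def]
    and eq_zero_iff = End_ring_eq_zero_iff[folded S_def]
    and image_submodule = End_ring_image_submodule[folded S_def]
  assume "\<not> ?thesis"
  \<comment> \<open>These images serve as \<open>N\<close> and \<open>L\<close> in
    \<open>star_prime_obtains_hom\<close>.\<close>
  then have "f ` carrier M \<noteq> {\<zero>\<^bsub>M\<^esub>}" "g ` carrier M \<noteq> {\<zero>\<^bsub>M\<^esub>}"
    using f g by (auto simp: eq_zero_iff)
  then obtain h y where h: "h \<in> carrier S" "h ` carrier M \<subseteq> g ` carrier M"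
    and y: "y \<in> f ` carrier M" "h y \<noteq> \<zero>\<^bsub>M\<^esub>"
    using star_prime_obtains_hom[OF star] image_submodule f g unfolding S_def by metis
  have "h \<otimes>\<^bsub>S\<^esub> s \<otimes>\<^bsub>S\<^esub> f = \<zero>\<^bsub>S\<^esub>" if s: "s \<in> carrier S" for s
  proof -
    have "f (s (h x)) = \<zero>\<^bsub>M\<^esub>" if x: "x \<in> carrier M" for x
    proof -
      obtain z where z: "z \<in> carrier M" "h x = g z"
        using h x by blast
      have "g \<otimes>\<^bsub>S\<^esub> s \<otimes>\<^bsub>S\<^esub> f = \<zero>\<^bsub>S\<^esub>"
        using gf s by blast
      then show ?thesis
        using z s f g by (simp add: eq_zero_iff mult_apply)
    qed
    then show ?thesis
      using s f h by (simp add: eq_zero_iff mult_apply)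
  qed
  \<comment> \<open>\<open>swap\<close> is applied with \<open>h\<close> in place of
    \<open>g\<close>; the middle factor \<open>1\<close> yields \<open>f h = 0\<close>, although
    \<open>h\<close> is non-zero at \<open>y\<close> in the image of \<open>f\<close>.\<close>
  then have "f \<otimes>\<^bsub>S\<^esub> \<one>\<^bsub>S\<^esub> \<otimes>\<^bsub>S\<^esub> h = \<zero>\<^bsub>S\<^esub>"
    using f h by (intro swap) auto
  then show False
    using y f h by (auto simp: eq_zero_iff mult_apply)
qed

end

theorem mainTheorem2:
  fixes R :: "('r, 'm) ring_scheme" and M :: "('r, 'a, 'n) module_scheme"
    and S :: "('a \<Rightarrow> 'a) ring"
  assumes "prime_ring R"
    and "left_module R M"
    and "faithful_module R M"
    and "star_prime_module R M"
    and S_def: "S = End_ring R M"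
  shows "(prime_ring S \<longleftrightarrow> semiprime_ring S)
    \<and> (prime_ring S \<longleftrightarrow> (\<forall>I. ideal I S \<longrightarrow> left_ann S I \<subseteq> right_ann S I))
    \<and> (prime_ring S \<longleftrightarrow> (\<forall>f\<in>carrier S. \<forall>g\<in>carrier S.
          (\<forall>s\<in>carrier S. g \<otimes>\<^bsub>S\<^esub> s \<otimes>\<^bsub>S\<^esub> f = \<zero>\<^bsub>S\<^esub>) \<longrightarrow>
          (\<forall>s\<in>carrier S. f \<otimes>\<^bsub>S\<^esub> s \<otimes>\<^bsub>S\<^esub> g = \<zero>\<^bsub>S\<^esub>)))"
    (is "(?a \<longleftrightarrow> ?b) \<and> (?a \<longleftrightarrow> ?c) \<and> (?a \<longleftrightarrow> ?d)")
proof -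
  interpret left_module R M by (rule assms(2))
  interpret S: ring S unfolding S_def by (rule End_ring_is_ring)
  have "?a \<Longrightarrow> ?b"
    by (rule prime_ring.prime_ring_imp_semiprime)
  moreover have "?b \<Longrightarrow> ?c"
    using semiprime_ring.left_ann_subset_right_ann by blast
  moreover have "?c \<Longrightarrow> ?d"
    using S.left_ann_subset_right_ann_imp_swap by blast
  moreover have "?a" if d: ?d
  proof (rule S.prime_ringI_elementwise)
    show "\<one>\<^bsub>S\<^esub> \<noteq> \<zero>\<^bsub>S\<^esub>"
      unfolding S_def
      by (intro faithful_imp_nonzero assms(3) prime_ring.one_not_zero assms(1))
    show "g = \<zero>\<^bsub>S\<^esub> \<or> f = \<zero>\<^bsub>S\<^esub>"
      if "g \<in> carrier S" "f \<in> carrier S" "\<forall>s\<in>carrier S. g \<otimes>\<^bsub>S\<^esub> s \<otimes>\<^bsub>S\<^esub> f = \<zero>\<^bsub>S\<^esub>" for f g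
      using star_prime_swap_imp_zero[OF assms(4), folded S_def] d that by blast
  qed
  ultimately show ?thesis
    by blast
qed

end
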